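(* Let $\mathbf{k}$ be an algebraically closed field of characteristic $0$. Then any simple finite-dimensional transposed Novikov-Poisson algebra over $\mathbf{k}$ is one-dimensional.
   Context: All binary operations are $\mathbf{k}$-bilinear and algebras need not be unital. A (left) Novikov algebra $(A,\circ)$ is a vector space with a binary operation satisfying $(x\circ y)\circ z=(x\circ z)\circ y$ and $(x\circ y)\circ z-x\circ(y\circ z)=(y\circ x)\circ z-y\circ(x\circ z)$ for all $x,y,z$. A transposed Novikov-Poisson algebra is a triple $(A,\cdot,\circ)$ where $(A,\cdot)$ is a commutative associative algebra, $(A,\circ)$ is a Novikov algebra, and for all $x,y,z\in A$: $(x\cdot y)\circ z=(x\cdot z)\circ y$ and $2z\cdot(x\circ y)=(z\cdot x)\circ y+x\circ(z\cdot y)$. It is trivial if $\cdot$ is zero or $\circ$ is zero. An ideal of $(A,\cdot,\circ)$ is a subspace that is a (two-sided) ideal of both $(A,\cdot)$ and $(A,\circ)$; the ideals $0$ and $A$ are called trivial. A non-trivial transposed Novikov-Poisson algebra is simple if it has no non-trivial ideals (so a simple transposed Novikov-Poisson algebra is by definition non-trivial). *)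

theory Defs
  imports "HOL-Computational_Algebra.Computational_Algebra"
begin

text \<open>The underlying vector space is a whole type, with an explicit scalar multiplication
  \<^term>\<open>scale\<close> as in \<^theory>\<open>HOL.Vector_Spaces\<close>; algebras need not be unital.\<close>

locale bilinear_operation = vector_space scale
  for scale :: "'k::field \<Rightarrow> 'a::ab_group_add \<Rightarrow> 'a" +
  fixes f :: "'a \<Rightarrow> 'a \<Rightarrow> 'a"
  assumes linear_left: "Vector_Spaces.linear scale scale (\<lambda>x. f x y)"
    and linear_right: "Vector_Spaces.linear scale scale (\<lambda>y. f x y)"

locale comm_assoc_algebra = bilinear_operation scale mul
  for scale :: "'k::field \<Rightarrow> 'a::ab_group_add \<Rightarrow> 'a"
    and mul :: "'a \<Rightarrow> 'a \<Rightarrow> 'a" +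
  assumes mul_assoc: "mul (mul x y) z = mul x (mul y z)"
    and mul_commute: "mul x y = mul y x"

locale novikov_algebra = bilinear_operation scale circ
  for scale :: "'k::field \<Rightarrow> 'a::ab_group_add \<Rightarrow> 'a"
    and circ :: "'a \<Rightarrow> 'a \<Rightarrow> 'a" +
  assumes right_commute: "circ (circ x y) z = circ (circ x z) y"
    and left_symmetric:
      "circ (circ x y) z - circ x (circ y z) = circ (circ y x) z - circ y (circ x z)"

locale transposed_novikov_poisson =
  comm_assoc_algebra scale mul + novikov_algebra scale circ
  for scale :: "'k::field \<Rightarrow> 'a::ab_group_add \<Rightarrow> 'a"
    and mul circ :: "'a \<Rightarrow> 'a \<Rightarrow> 'a" +
  assumes mul_circ: "circ (mul x y) z = circ (mul x z) y"
    and transposed_leibniz: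
      "scale 2 (mul z (circ x y)) = circ (mul z x) y + circ x (mul z y)"
begin

definition trivial :: bool where
  "trivial \<longleftrightarrow> (\<forall>x y. mul x y = 0) \<or> (\<forall>x y. circ x y = 0)"

definition is_ideal :: "'a set \<Rightarrow> bool" where
  "is_ideal I \<longleftrightarrow> subspace I \<and>
    (\<forall>x\<in>I. \<forall>a. mul a x \<in> I \<and> mul x a \<in> I \<and> circ a x \<in> I \<and> circ x a \<in> I)"

end

locale simple_transposed_novikov_poisson = transposed_novikov_poisson scale mul circ
  for scale :: "'k::field \<Rightarrow> 'a::ab_group_add \<Rightarrow> 'a"
    and mul circ :: "'a \<Rightarrow> 'a \<Rightarrow> 'a" +
  assumes non_trivial: "\<not> trivial"
    and only_trivial_ideals: "is_ideal I \<Longrightarrow> I = {0} \<or> I = UNIV"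

end

theory Submission
  imports Defs
begin

text \<open>
  The idea is Schur's lemma for the centroid: an operator that commutes with all
  multiplications of \<open>\<cdot>\<close> and \<open>\<circ>\<close> has ideals as its eigenspaces, so on a simple
  finite-dimensional algebra over an algebraically closed field it is a scalar.  Multiplication
  by \<open>z\<close> need not belong to the centroid, because the transposed Leibniz rule only controls the
  sum of \<open>(z \<cdot> x) \<circ> y\<close> and \<open>x \<circ> (z \<cdot> y)\<close>.  Multiplication by a product \<open>v \<cdot> w\<close>
  does (lemmas \<open>product_mul_circ_left\<close> and
  \<open>product_mul_circ_right\<close>): applying the Leibniz rule once with
  \<open>v \<cdot> w\<close> and twice with \<open>w\<close> and \<open>v\<close>, and using that \<open>(x \<cdot> y) \<circ> z\<close> is symmetric
  in its three arguments, separates the two terms.  Hence \<open>v \<cdot> w\<close> acts as a scalar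
  \<open>c v w\<close>.

  It remains to exclude that all these scalars vanish, that is, that \<open>A \<cdot> A \<cdot> A = 0\<close>.  The
  elements \<open>x\<close> with \<open>x \<cdot> A = 0\<close> and \<open>x \<circ> (A \<cdot> A) = 0\<close> form an ideal (lemma
  \<open>is_ideal_square_annihilator\<close>), which is proper because \<open>\<cdot>\<close> is not zero, and which in that case would
  contain \<open>A \<cdot> A\<close>; so it would be a proper non-zero ideal.

  Therefore some product acts as an invertible scalar, and rescaling it gives a unit \<open>e\<close> of
  \<open>(A, \<cdot>)\<close>.  Now every element \<open>x = x \<cdot> e\<close> is a product, so it acts as a scalar, and applying it
  to \<open>e\<close> shows that \<open>x\<close> is a multiple of \<open>e\<close>.
\<close>

section \<open>Eigenvalues over algebraically closed fields\<close>

locale linear_endomorphism = vector_space scale + endo: Vector_Spaces.linear scale scale f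
  for scale :: "'k::field \<Rightarrow> 'a::ab_group_add \<Rightarrow> 'a" and f
begin

text \<open>Horner's scheme for \<open>p(f) x\<close>; it makes the action of \<open>pCons\<close>, and so of a linear factor,
  a direct unfolding.\<close>

definition poly_action :: "'k poly \<Rightarrow> 'a \<Rightarrow> 'a" where
  "poly_action p x = fold_coeffs (\<lambda>a y. scale a x + f y) p 0"

lemma poly_action_0: "poly_action 0 x = 0"
  by (simp add: poly_action_def)

lemma poly_action_pCons: "poly_action (pCons a p) x = scale a x + f (poly_action p x)"
proof (cases "p = 0 \<and> a = 0")
  case True
  then show ?thesis by (simp add: poly_action_def endo.zero)
next
  case False
  then show ?thesis by (auto simp: poly_action_def)
qed

lemma poly_action_add: "poly_action (p + q) x = poly_action p x + poly_action q x"
  by (induction p q rule: poly_induct2)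
    (simp_all add: poly_action_0 poly_action_pCons endo.add scale_left_distrib algebra_simps)

lemma poly_action_smult: "poly_action (smult c p) x = scale c (poly_action p x)"
  by (induction p) (simp_all add: poly_action_0 poly_action_pCons endo.scale scale_right_distrib)

lemma poly_action_monom: "poly_action (monom c n) x = scale c ((f ^^ n) x)"
  by (induction n) (simp_all add: monom_0 monom_Suc poly_action_0 poly_action_pCons endo.zero endo.scale)

lemma poly_action_sum: "poly_action (sum p I) x = (\<Sum>i\<in>I. poly_action (p i) x)"
  by (induction I rule: infinite_finite_induct) (simp_all add: poly_action_0 poly_action_add)

lemma poly_action_linear_factor:
  "poly_action ([:- c, 1:] * q) x = f (poly_action q x) - scale c (poly_action q x)"
  using poly_action_add[of "smult (- c) q" "pCons 0 q" x] poly_action_smult[of "- c" q x]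
  by (simp add: poly_action_pCons)

text \<open>The vectors \<open>x, f x, \<dots>\<close> up to the power \<open>dimension\<close> are one too many to be
  independent.  Dependence speaks of the set of these vectors, so a repetition among them is
  treated apart.\<close>

lemma exists_annihilating_poly:
  assumes "finite_dimensional_vector_space scale B"
  shows "\<exists>p. p \<noteq> 0 \<and> poly_action p x = 0"
proof -
  interpret finite_dimensional_vector_space scale B by fact
  let ?v = "\<lambda>i. (f ^^ i) x"
  let ?I = "{..dimension}"
  show ?thesis
  proof (cases "inj_on ?v ?I")
    case False
    then obtain i j where ij: "i \<noteq> j" "?v i = ?v j"
      by (auto simp: inj_on_def)
    have "coeff (monom 1 i + monom (- 1) j :: 'k poly) i \<noteq> 0"
      using ij(1) by simp
    then have "monom 1 i + monom (- 1) j \<noteq> (0 :: 'k poly)"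
      by fastforce
    moreover have "poly_action (monom 1 i + monom (- 1) j) x = 0"
      using ij(2) by (simp add: poly_action_add poly_action_monom)
    ultimately show ?thesis by blast
  next
    case True
    have "dependent (?v ` ?I)"
      using True independent_card_le_dim[of "?v ` ?I" UNIV] dim_subset_UNIV[of UNIV]
      by (auto simp: card_image)
    then obtain u i where u: "i \<in> ?I" "u (?v i) \<noteq> 0"
      "(\<Sum>v\<in>?v ` ?I. scale (u v) v) = 0"
      by (auto simp: dependent_finite)
    let ?p = "\<Sum>i\<in>?I. monom (u (?v i)) i"
    have "coeff ?p i = u (?v i)"
      using u(1) by (simp add: coeff_sum sum.delta' if_distrib cong: if_cong)
    then have "?p \<noteq> 0"
      using u(2) by fastforce
    moreover have "poly_action ?p x = (\<Sum>i\<in>?I. scale (u (?v i)) (?v i))"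
      by (simp add: poly_action_sum poly_action_monom)
    then have "poly_action ?p x = 0"
      using u(3) by (simp add: sum.reindex[OF True])
    ultimately show ?thesis by blast
  qed
qed

end

text \<open>For \<open>x \<noteq> 0\<close> and an annihilating polynomial of least degree, splitting off a root \<open>c\<close>
  leaves a polynomial that no longer annihilates \<open>x\<close>, and it maps \<open>x\<close> to an eigenvector.\<close>

lemma exists_eigenvector:
  fixes scale :: "'k::alg_closed_field \<Rightarrow> 'a::ab_group_add \<Rightarrow> 'a" and f :: "'a \<Rightarrow> 'a" and x :: 'a
  assumes "finite_dimensional_vector_space scale B"
    and f: "Vector_Spaces.linear scale scale f"
    and x: "x \<noteq> 0"
  shows "\<exists>c v. v \<noteq> 0 \<and> f v = scale c v"
proof -
  interpret finite_dimensional_vector_space scale B by fact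
  interpret linear_endomorphism scale f
    by (intro linear_endomorphism.intro vector_space_axioms f)
  let ?P = "\<lambda>p. p \<noteq> 0 \<and> poly_action p x = 0"
  obtain p where p: "?P p" and least: "\<And>q. ?P q \<Longrightarrow> degree p \<le> degree q"
    using exists_annihilating_poly[OF assms(1), of x] ex_has_least_nat[of ?P _ degree] by blast
  have "degree p > 0"
  proof (rule ccontr)
    assume "\<not> degree p > 0"
    then obtain a where "p = [:a:]"
      by (auto elim: degree_eq_zeroE)
    then show False
      using p x by (auto simp: poly_action_pCons poly_action_0 endo.zero)
  qed
  then obtain c where "poly p c = 0"
    using alg_closed_imp_poly_has_root by blast
  then obtain q where q: "p = [:- c, 1:] * q"
    by (auto simp: poly_eq_0_iff_dvd elim: dvdE)
  have "q \<noteq> 0"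
    using p q by auto
  then have "degree p = Suc (degree q)"
    unfolding q by (subst degree_mult_eq) auto
  then have "poly_action q x \<noteq> 0"
    using least[of q] \<open>q \<noteq> 0\<close> by auto
  moreover have "f (poly_action q x) = scale c (poly_action q x)"
    using p unfolding q by (simp only: poly_action_linear_factor) simp
  ultimately show ?thesis by blast
qed

section \<open>Multiplication by products, and an annihilator ideal\<close>

context bilinear_operation
begin

lemma add_left: "f (x + y) z = f x z + f y z"
  using linear_left by (simp add: Vector_Spaces.linear_iff)

lemma add_right: "f z (x + y) = f z x + f z y"
  using linear_right by (simp add: Vector_Spaces.linear_iff)

lemma scale_left: "f (scale c x) z = scale c (f x z)"
  using linear_left by (simp add: Vector_Spaces.linear_iff)

lemma scale_right: "f z (scale c x) = scale c (f z x)"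
  using linear_right by (simp add: Vector_Spaces.linear_iff)

lemma zero_left: "f 0 z = 0"
  using scale_left[of 0] by simp

lemma zero_right: "f z 0 = 0"
  using scale_right[of _ 0] by simp

lemmas bilinear = add_left add_right scale_left scale_right zero_left zero_right

end

context transposed_novikov_poisson
begin

lemmas mul_bilinear = bilinear_operation.bilinear
  [OF comm_assoc_algebra.axioms(1)[OF comm_assoc_algebra_axioms]]

lemmas circ_bilinear = bilinear_operation.bilinear
  [OF novikov_algebra.axioms(1)[OF novikov_algebra_axioms]]

text \<open>Comparing the Leibniz rule for \<open>v \<cdot> w\<close> with the rules for \<open>w\<close> and then \<open>v\<close>, the
  mixed terms \<open>(w \<cdot> x) \<circ> (v \<cdot> y)\<close> and \<open>(v \<cdot> x) \<circ> (w \<cdot> y)\<close> both equal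
  \<open>(v \<cdot> w \<cdot> x) \<circ> y\<close> by symmetry of \<open>(a \<cdot> b) \<circ> c\<close>.  What remains is
  \<open>(v \<cdot> w \<cdot> x) \<circ> y = x \<circ> (v \<cdot> w \<cdot> y)\<close>, so the two terms of the Leibniz rule for
  \<open>v \<cdot> w\<close> agree.\<close>

lemma
  assumes two: "(2 :: 'k) \<noteq> 0"
  shows product_mul_circ_left: "mul (mul v w) (circ x y) = circ (mul (mul v w) x) y" (is ?left)
    and product_mul_circ_right: "mul (mul v w) (circ x y) = circ x (mul (mul v w) y)" (is ?right)
proof -
  let ?P = "circ (mul (mul v w) x) y" and ?Q = "circ x (mul (mul v w) y)"
  let ?u = "mul (mul v w) (circ x y)"
  have u: "scale 2 ?u = ?P + ?Q"
    by (rule transposed_leibniz)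
  have mixed: "circ (mul a x) (mul b y) = circ (mul (mul a b) x) y" for a b
    by (metis mul_circ mul_assoc mul_commute)
  have "scale 2 (scale 2 ?u) = scale 2 (mul v (scale 2 (mul w (circ x y))))"
    by (simp add: mul_bilinear mul_assoc)
  also have "\<dots> = scale 2 (mul v (circ (mul w x) y)) + scale 2 (mul v (circ x (mul w y)))"
    by (simp add: transposed_leibniz mul_bilinear scale_right_distrib)
  also have "\<dots> = (?P + circ (mul w x) (mul v y)) + (circ (mul v x) (mul w y) + ?Q)"
    by (simp add: transposed_leibniz mul_assoc)
  also have "\<dots> = (?P + ?P) + (?P + ?Q)"
    using mixed[of w v] mixed[of v w] by (simp add: mul_commute)
  finally have "(?P + ?Q) + (?P + ?Q) = (?P + ?P) + (?P + ?Q)"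
    unfolding u by (simp add: scale_left_distrib[of 1 1, simplified])
  then have "?Q = ?P"
    by simp
  then have "scale 2 ?u = scale 2 ?P"
    using u by (simp add: scale_left_distrib[of 1 1, simplified])
  then show ?left
    using two by simp
  with \<open>?Q = ?P\<close> show ?right
    by simp
qed

text \<open>The condition \<open>x \<circ> (A \<cdot> A) = 0\<close> is what the Leibniz rule asks for: it makes
  \<open>y \<cdot> (x \<circ> a)\<close> vanish when \<open>x \<cdot> A = 0\<close>, whereas the annihilator of \<open>\<cdot>\<close> alone leaves
  the term \<open>x \<circ> (y \<cdot> a)\<close>.  It is inherited by \<open>x \<circ> a\<close> and \<open>a \<circ> x\<close> because right
  multiplications commute.\<close>

lemma is_ideal_square_annihilator:
  assumes two: "(2 :: 'k) \<noteq> 0"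
  shows "is_ideal {x. (\<forall>y. mul y x = 0) \<and> (\<forall>y z. circ x (mul y z) = 0)}" (is "is_ideal ?M")
  unfolding is_ideal_def
proof (intro conjI ballI allI)
  show "subspace ?M"
    by (rule subspaceI) (simp_all add: mul_bilinear circ_bilinear)
next
  fix x a
  assume "x \<in> ?M"
  then have mul0: "mul y x = 0" and circ0: "circ x (mul y z) = 0" for y z
    by simp_all
  have mul0': "mul x y = 0" for y
    using mul0 by (simp add: mul_commute[of x y])
  have product0: "circ (mul y z) x = 0" for y z
    using mul_circ[of y z x] by (simp add: mul0 circ_bilinear)
  show "mul a x \<in> ?M" "mul x a \<in> ?M"
    by (simp_all add: mul0 mul0' mul_bilinear circ_bilinear)
  have "scale 2 (mul y (circ a x)) = 0" for y
    by (simp add: transposed_leibniz mul0 product0 circ_bilinear)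
  moreover have "circ (circ a x) (mul y z) = 0" for y z
  proof -
    \<comment> \<open>Right multiplications commute, so it suffices that \<open>x\<close>, acting from the right, kills
      \<open>a \<circ> (y \<cdot> z)\<close>; the Leibniz rule writes it with elements of \<open>A \<cdot> A\<close> and
      \<open>(A \<cdot> A) \<circ> A\<close>, on which \<open>x\<close> acts as zero.\<close>
    have "circ a (mul y z) = scale 2 (mul y (circ a z)) - circ (mul y a) z"
      by (simp add: transposed_leibniz)
    moreover have "circ (circ (mul y a) z) x = 0"
      by (metis product0 right_commute circ_bilinear(5))
    moreover have "circ (p - q) x = circ p x - circ q x" for p q
      by (metis circ_bilinear(1) diff_eq_eq)
    ultimately have "circ (circ a (mul y z)) x = 0"
      by (simp add: product0 circ_bilinear)
    then show ?thesis
      by (simp add: right_commute[of a x])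
  qed
  ultimately show "circ a x \<in> ?M"
    using two by simp
  have "scale 2 (mul y (circ x a)) = 0" for y
    by (simp add: transposed_leibniz mul0 circ0 circ_bilinear)
  moreover have "circ (circ x a) (mul y z) = 0" for y z
    by (simp add: right_commute[of x a] circ0 circ_bilinear)
  ultimately show "circ x a \<in> ?M"
    using two by simp
qed

end

section \<open>Simple algebras\<close>

context simple_transposed_novikov_poisson
begin

text \<open>If all triple products vanish, then \<open>(v \<cdot> w) \<circ> (y \<cdot> z) = (v \<cdot> (y \<cdot> z)) \<circ> w = 0\<close>, so
  the ideal above contains every product.\<close>

lemma triple_product_nonzero:
  assumes two: "(2 :: 'k) \<noteq> 0"
  shows "\<exists>v w x. mul (mul v w) x \<noteq> 0"
proof (rule ccontr)
  assume "\<nexists>v w x. mul (mul v w) x \<noteq> 0"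
  then have triple0: "mul (mul v w) x = 0" "mul x (mul v w) = 0" for v w x
    by (auto simp: mul_commute)
  let ?M = "{x. (\<forall>y. mul y x = 0) \<and> (\<forall>y z. circ x (mul y z) = 0)}"
  have products: "mul v w \<in> ?M" for v w
    by (simp add: triple0 circ_bilinear mul_circ[of v w])
  have "?M = {0} \<or> ?M = UNIV"
    by (intro only_trivial_ideals is_ideal_square_annihilator two)
  then have "mul v w = 0" for v w
    using products by fast
  then show False
    using non_trivial by (simp add: trivial_def)
qed

text \<open>Each eigenspace of an operator in the centroid is an ideal.\<close>

lemma centroid_eq_scale:
  assumes g: "Vector_Spaces.linear scale scale g"
    and centroid: "\<And>x y. g (mul x y) = mul (g x) y"
      "\<And>x y. g (circ x y) = circ (g x) y" "\<And>x y. g (circ x y) = circ x (g y)"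
    and eigen: "g v = scale c v" "v \<noteq> 0"
  shows "g x = scale c x"
proof -
  interpret g: Vector_Spaces.linear scale scale g by fact
  let ?E = "{x. g x = scale c x}"
  have mul: "mul x a \<in> ?E" if "x \<in> ?E" for x a
    using that by (simp add: centroid(1) mul_bilinear)
  have "is_ideal ?E"
    unfolding is_ideal_def
  proof (intro conjI ballI allI)
    show "subspace ?E"
      by (rule subspaceI)
        (simp_all add: g.zero g.add g.scale scale_right_distrib mult.commute)
  next
    fix x a
    assume x: "x \<in> ?E"
    show "mul a x \<in> ?E" "mul x a \<in> ?E"
      using mul[OF x] by (simp_all add: mul_commute[of a x])
    show "circ a x \<in> ?E"
      using x by (simp add: centroid(3) circ_bilinear)
    show "circ x a \<in> ?E"
      using x by (simp add: centroid(2) circ_bilinear)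
  qed
  then show ?thesis
    using only_trivial_ideals eigen by blast
qed

end

lemma product_acts_as_scalar:
  fixes scale :: "'k::{alg_closed_field, field_char_0} \<Rightarrow> 'a::ab_group_add \<Rightarrow> 'a"
  assumes "simple_transposed_novikov_poisson scale mul circ"
    and fin: "finite_dimensional_vector_space scale B"
  shows "\<exists>c. \<forall>x. mul (mul v w) x = scale c x"
proof -
  interpret simple_transposed_novikov_poisson scale mul circ by fact
  have lin: "Vector_Spaces.linear scale scale (mul (mul v w))"
    using bilinear_operation.linear_right comm_assoc_algebra.axioms(1)
      comm_assoc_algebra_axioms by blast
  have two: "(2 :: 'k) \<noteq> 0"
    by simp
  obtain y :: 'a where "y \<noteq> 0"
    using triple_product_nonzero[OF two] by blast
  then obtain c z where eigen: "z \<noteq> 0" "mul (mul v w) z = scale c z"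
    using exists_eigenvector[OF fin lin] by blast
  have "mul (mul v w) x = scale c x" for x
    by (rule centroid_eq_scale[OF lin _ product_mul_circ_left[OF two]
          product_mul_circ_right[OF two] eigen(2,1)]) (simp add: mul_assoc)
  then show ?thesis by blast
qed

theorem corollary4p10:
  fixes scale :: "'k::{alg_closed_field, field_char_0} \<Rightarrow> 'a::ab_group_add \<Rightarrow> 'a"
    and mul circ :: "'a \<Rightarrow> 'a \<Rightarrow> 'a"
    and B :: "'a set"
  assumes "simple_transposed_novikov_poisson scale mul circ"
    and "finite_dimensional_vector_space scale B"
  shows "vector_space.dim scale (UNIV :: 'a set) = 1"
proof -
  interpret simple_transposed_novikov_poisson scale mul circ by fact
  note scalar = product_acts_as_scalar[OF assms]
  obtain v w x where nonzero: "mul (mul v w) x \<noteq> 0"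
    using triple_product_nonzero by auto
  obtain c where c: "\<And>x. mul (mul v w) x = scale c x"
    using scalar by blast
  have "c \<noteq> 0"
    using nonzero by (auto simp: c)
  define e where "e = scale (inverse c) (mul v w)"
  have unit: "mul e x = x" for x
    using \<open>c \<noteq> 0\<close> by (simp add: e_def mul_bilinear c)
  have "e \<noteq> 0"
    using nonzero unit by (metis mul_bilinear(5))
  have "x \<in> span {e}" for x
  proof -
    obtain d where "mul (mul e x) e = scale d e"
      using scalar by blast
    then have "x = scale d e"
      by (simp add: unit mul_commute[of x e])
    then show ?thesis
      by (simp add: span_base span_scale)
  qed
  then have "span {e} = span UNIV"
    by auto
  then show ?thesis
    using dim_eq_card[of "{e}" UNIV] \<open>e \<noteq> 0\<close> by simp
qed

end
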